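(* Let $u:V\times[0,T_{\max}(u_0))\to\mathbb{R}$ be the solution of $$\partial_t u=\Delta u-au+|u|^{p-1}u\quad (x\in V,\ t>0),\qquad u(x,0)=u_0(x)\quad (x\in V)$$ with $u_0\geq 0$, where $[0,T_{\max}(u_0))$ is the maximal time interval on which the solution exists. If $J(u_0)<0$, then $$T_{\max}(u_0)\leq\frac{p+1}{(p-1)^2}|V|^{\frac{p-1}{2}}\|u_0\|_{L^2(V)}^{1-p};$$ while if $$0\leq J(u_0)<\frac{p-1}{2(p+1)}|V|^{\frac{1-p}{2}}\|u_0\|_{L^2(V)}^{1+p},$$ then $$T_{\max}(u_0)\leq\max\left\{\frac{(p+1)\left[\left(4(p+1)|V|^{\frac{p-1}{2}}J(u_0)\right)^{2/(p+1)}-(p-1)^{\frac{2}{p+1}}\|u_0\|_{L^2(V)}^2\right]}{(p-1)^{\frac{2}{p+1}}\left[2(p-1)|V|^{\frac{1-p}{2}}\|u_0\|_{L^2(V)}^{1+p}-4(p+1)J(u_0)\right]},\ \frac{2(p+1)\|u_0\|_{L^2(V)}^{1-p}}{(p-1)^2|V|^{\frac{1-p}{2}}}\right\}.$$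
   Context: $G=(V,E,\mu,\omega)$ is a finite connected graph with positive measure $\mu:V\to(0,\infty)$ and positive symmetric edge weights $\omega_{xy}=\omega_{yx}>0$; $y\sim x$ means that $x,y$ are joined by an edge. The $\mu$-Laplacian is $\Delta u(x)=\frac{1}{\mu(x)}\sum_{y\sim x}\omega_{xy}(u(y)-u(x))$, and $|\nabla u|^2(x)=\frac{1}{2\mu(x)}\sum_{y\sim x}\omega_{xy}(u(y)-u(x))^2$. $\int_V f\,d\mu=\sum_{x\in V}\mu(x)f(x)$, $\|f\|_{L^2(V)}=(\int_Vf^2d\mu)^{1/2}$, $|V|=\int_V1\,d\mu=\sum_{x\in V}\mu(x)$. Fixed data: $p>1$ and $a:V\to\mathbb{R}$ with $a\ge 0$ on $V$ and $a\not\equiv 0$. The energy is $J(u)=\frac12\int_V(|\nabla u|^2+au^2)d\mu-\frac{1}{p+1}\int_V|u|^{p+1}d\mu$. Solutions are $C^1$ in $t$ for each $x\in V$. *)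

theory Defs
  imports
    "HOL-Analysis.Analysis"
    "HOL-Library.Extended_Real"
    "Graph_Theory.Graph_Theory"
begin

text \<open>
  Undirected graphs are symmetric digraphs, without parallel edges because arcs are pairs.
  Loops are not excluded; they contribute nothing to the Laplacian or to the gradient.
  Connectedness includes that the vertex set is nonempty.  The name is qualified because
  it is also that of the topological notion.
\<close>

locale weighted_graph = pair_pseudo_graph G
  for G :: "'a pair_pre_digraph" +
  fixes \<mu> :: "'a \<Rightarrow> real" and \<omega> :: "'a \<Rightarrow> 'a \<Rightarrow> real"
  assumes connected: "Digraph_Component.connected (with_proj G)"
    and measure_pos: "x \<in> pverts G \<Longrightarrow> \<mu> x > 0"
    and weight_pos: "x \<rightarrow>\<^bsub>with_proj G\<^esub> y \<Longrightarrow> \<omega> x y > 0"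
    and weight_sym: "x \<rightarrow>\<^bsub>with_proj G\<^esub> y \<Longrightarrow> \<omega> x y = \<omega> y x"

definition laplacian ::
    "'a pair_pre_digraph \<Rightarrow> ('a \<Rightarrow> real) \<Rightarrow> ('a \<Rightarrow> 'a \<Rightarrow> real) \<Rightarrow> ('a \<Rightarrow> real) \<Rightarrow> 'a \<Rightarrow> real" where
  "laplacian G \<mu> \<omega> u x =
     1 / \<mu> x * (\<Sum>y | x \<rightarrow>\<^bsub>with_proj G\<^esub> y. \<omega> x y * (u y - u x))"

definition grad_sq ::
    "'a pair_pre_digraph \<Rightarrow> ('a \<Rightarrow> real) \<Rightarrow> ('a \<Rightarrow> 'a \<Rightarrow> real) \<Rightarrow> ('a \<Rightarrow> real) \<Rightarrow> 'a \<Rightarrow> real" where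
  "grad_sq G \<mu> \<omega> u x =
     1 / (2 * \<mu> x) * (\<Sum>y | x \<rightarrow>\<^bsub>with_proj G\<^esub> y. \<omega> x y * (u y - u x)\<^sup>2)"

definition vintegral :: "'a pair_pre_digraph \<Rightarrow> ('a \<Rightarrow> real) \<Rightarrow> ('a \<Rightarrow> real) \<Rightarrow> real" where
  "vintegral G \<mu> f = (\<Sum>x\<in>pverts G. \<mu> x * f x)"

definition vnorm2 :: "'a pair_pre_digraph \<Rightarrow> ('a \<Rightarrow> real) \<Rightarrow> ('a \<Rightarrow> real) \<Rightarrow> real" where
  "vnorm2 G \<mu> f = sqrt (vintegral G \<mu> (\<lambda>x. (f x)\<^sup>2))"

definition vvolume :: "'a pair_pre_digraph \<Rightarrow> ('a \<Rightarrow> real) \<Rightarrow> real" where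
  "vvolume G \<mu> = vintegral G \<mu> (\<lambda>x. 1)"

definition energy ::
    "'a pair_pre_digraph \<Rightarrow> ('a \<Rightarrow> real) \<Rightarrow> ('a \<Rightarrow> 'a \<Rightarrow> real) \<Rightarrow> real \<Rightarrow> ('a \<Rightarrow> real)
      \<Rightarrow> ('a \<Rightarrow> real) \<Rightarrow> real" where
  "energy G \<mu> \<omega> p a u =
     1 / 2 * vintegral G \<mu> (\<lambda>x. grad_sq G \<mu> \<omega> u x + a x * (u x)\<^sup>2)
     - 1 / (p + 1) * vintegral G \<mu> (\<lambda>x. \<bar>u x\<bar> powr (p + 1))"

definition time_interval :: "ereal \<Rightarrow> real set" where
  "time_interval T = {t. 0 \<le> t \<and> ereal t < T}"

text \<open>
  \<open>is_solution G \<mu> \<omega> p a u0 T u\<close>: \<open>u x t\<close> is a solution on \<open>[0, T)\<close>, with \<open>T = \<infinity>\<close> allowed, of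
  the heat equation with initial value \<open>u0\<close>.  For each vertex it is continuously
  differentiable on \<open>[0, T)\<close>, the derivative at \<open>0\<close> being one-sided.  Values of \<open>u\<close> outside
  the vertex set and the time interval are irrelevant.
\<close>

definition is_solution ::
    "'a pair_pre_digraph \<Rightarrow> ('a \<Rightarrow> real) \<Rightarrow> ('a \<Rightarrow> 'a \<Rightarrow> real) \<Rightarrow> real \<Rightarrow> ('a \<Rightarrow> real)
      \<Rightarrow> ('a \<Rightarrow> real) \<Rightarrow> ereal \<Rightarrow> ('a \<Rightarrow> real \<Rightarrow> real) \<Rightarrow> bool" where
  "is_solution G \<mu> \<omega> p a u0 T u \<longleftrightarrow>
     0 < T \<and>
     (\<forall>x\<in>pverts G. u x 0 = u0 x) \<and>
     (\<exists>u'. \<forall>x\<in>pverts G.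
        continuous_on (time_interval T) (u' x) \<and>
        (\<forall>t\<in>time_interval T. (u x has_real_derivative u' x t) (at t within time_interval T)) \<and>
        (\<forall>t\<in>time_interval T. 0 < t \<longrightarrow>
           u' x t = laplacian G \<mu> \<omega> (\<lambda>y. u y t) x - a x * u x t
                    + \<bar>u x t\<bar> powr (p - 1) * u x t))"

text \<open>
  Solutions with the same initial value agree on the common part of their intervals (the
  nonlinearity is locally Lipschitz as \<open>p > 1\<close>), so \<open>[0, T_max)\<close> is the maximal interval of
  existence.
\<close>

definition T_max ::
    "'a pair_pre_digraph \<Rightarrow> ('a \<Rightarrow> real) \<Rightarrow> ('a \<Rightarrow> 'a \<Rightarrow> real) \<Rightarrow> real \<Rightarrow> ('a \<Rightarrow> real)
      \<Rightarrow> ('a \<Rightarrow> real) \<Rightarrow> ereal" where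
  "T_max G \<mu> \<omega> p a u0 = Sup {T. \<exists>u. is_solution G \<mu> \<omega> p a u0 T u}"

end

theory Submission
  imports Defs
begin

text \<open>
  Along a solution let \<open>y = \<integral> u\<^sup>2\<close> and \<open>M = - 4 * J(u)\<close>.  Testing the equation with \<open>u\<close> and using
  Jensen's inequality for \<open>\<integral> \<bar>u\<bar> powr (p + 1)\<close> gives
  \<open>y' \<ge> c * y powr (1 + r) + M\<close> with \<open>r = (p - 1) / 2\<close> and
  \<open>c = 2 * (p - 1) / (p + 1) * |V| powr (- r)\<close>.  The equation is the gradient flow of \<open>J\<close>, so
  \<open>M' \<ge> 0\<close>; both hypotheses on the initial energy make the right-hand side positive at time
  \<open>0\<close>, and it then stays positive.  A bound on every \<open>\<tau>\<close> such that \<open>[0, \<tau>]\<close> lies in the interval of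
  existence bounds the length of that interval.

  If \<open>J(u\<^sub>0) < 0\<close>, then \<open>y' \<ge> c * y powr (1 + r)\<close>, and integration gives the bound.

  If \<open>J(u\<^sub>0) \<ge> 0\<close>, monotonicity of \<open>M\<close> alone suggests waiting until \<open>y\<close> is so large that half of
  the power term dominates the energy, and integrating the other half from there on.  The two
  entries of the maximum are a bound for this waiting time and the blow-up time for half of the
  power term, started from the initial value; but the argument bounds the lifespan by a sum, not
  by a maximum.
  To obtain the maximum, the dissipation of the energy is used quantitatively: Cauchy-Schwarz gives
  \<open>(y')\<^sup>2 \<le> M' * y\<close>, hence \<open>M / y - (c / r) * y powr r\<close> is nondecreasing
  (lemma \<open>M_lower_bound\<close>), and \<open>y\<close> satisfies a Bernoulli inequality
  \<open>y' \<ge> \<alpha> * y powr (1 + r) - \<gamma> * y\<close> whose blow-up time is explicit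
  (lemma \<open>time_le_if_M_nonpos\<close>).  In the time unit \<open>y(0) powr (- r) / c\<close> it equals
  \<open>ln ((1 + 1/r) / (1 - w)) / (1 + r * w)\<close> with \<open>w = 4 * J(u\<^sub>0) / (c * y(0) powr (1 + r))\<close>, and
  the remaining comparison with the maximum is an inequality between elementary functions of \<open>r\<close>
  and \<open>w\<close> (lemma \<open>bernoulli_time_le_max\<close>).
\<close>

section \<open>Comparison of the blow-up times\<close>

text \<open>
  The equation \<open>- ln (1 - w) = 2 * w\<close> has a root near \<open>0.797\<close>.  Below it the second
  of the two time bounds suffices; the first one is sharp enough only from about \<open>0.77\<close> on.  The
  threshold \<open>79/100\<close> between these numbers needs \<open>ln (21/100)\<close> and \<open>ln 2\<close> to two or three digits.
\<close>
lemma exp_158_hundredths_ge: "1 / (21/100) \<le> exp (158/100 :: real)"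
proof -
  \<comment> \<open>the quadratic Taylor bound is sharp enough only after dividing the exponent by eight\<close>
  have "(1217/1000 :: real) \<le> exp (158/800)"
    using exp_lower_Taylor_quadratic[of "158/800"] by (simp add: power2_eq_square)
  then have "(1217/1000 :: real) ^ 8 \<le> exp (158/800) ^ 8"
    by (intro power_mono) auto
  also have "\<dots> = exp (158/100)"
    by (simp flip: exp_of_nat_mult)
  finally show ?thesis
    by (simp add: power_divide divide_le_eq)
qed

lemma ln2_ge_693_thousandths: "693/1000 \<le> ln (2 :: real)"
  using ln_approx_bounds[of 2 3, simplified, simplified eval_nat_numeral, simplified] by simp

text \<open>
  Convexity: the graph of \<open>exp (- 2 * w)\<close> lies below its chord over \<open>[0, 79/100]\<close>, and since
  \<open>exp (- 158/100) \<le> 21/100\<close> that chord lies below \<open>1 - w\<close>.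
\<close>
lemma gt_if_minus_ln_gt:
  fixes w :: real
  assumes "0 \<le> w" "w < 1" "2 * w < - ln (1 - w)"
  shows "79/100 < w"
proof (rule ccontr)
  assume "\<not> 79/100 < w"
  then have w: "w \<le> 79/100" by simp
  define s where "s = w / (79/100)"
  have s: "0 \<le> s" "s \<le> 1" and ws: "w = 79/100 * s"
    using w assms(1) by (auto simp: s_def)
  have "exp ((1 - s) *\<^sub>R 0 + s *\<^sub>R (-158/100)) \<le> (1 - s) * exp 0 + s * exp (-158/100 :: real)"
    using s by (intro convex_onD[OF exp_convex]) auto
  moreover have "exp (-158/100 :: real) \<le> 21/100"
    using exp_158_hundredths_ge by (simp add: exp_minus field_simps)
  then have "s * exp (-158/100 :: real) \<le> s * (21/100)"
    using s by (intro mult_left_mono)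
  moreover have "(1 - s) *\<^sub>R 0 + s *\<^sub>R (-158/100) = - 2 * w" by (simp add: ws)
  ultimately have "exp (- 2 * w) \<le> (1 - s) + s * (21/100)" by simp
  also have "\<dots> = 1 - w" by (simp add: ws)
  finally have "- 2 * w \<le> ln (1 - w)"
    using assms(2) by (simp add: ln_ge_iff)
  with assms(3) show False by simp
qed

text \<open>
  In terms of \<open>v = 1 - w < 21/100\<close> the claim is a polynomial inequality once the three logarithms
  are replaced by tangent bounds: \<open>ln v\<close> by its tangent at \<open>21/100\<close>, taken as a function of
  \<open>1 / v\<close>, and \<open>w * ln w\<close> by \<open>- v\<close>, while \<open>ln 2 \<ge> 693/1000\<close>.
\<close>
lemma ln_comparison:
  fixes w :: real
  assumes "79/100 < w" "w < 1"
  shows "2 * (- ln (1 - w) - w) / w \<le> ln (2 * w) / (1 - w)"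
proof -
  define v where "v = 1 - w"
  have v: "0 < v" "v < 21/100" and w: "w = 1 - v" "0 < w"
    using assms by (auto simp: v_def)
  have "ln (21/100 / v) \<le> 21/100 / v - 1"
    using v by (intro ln_le_minus_one) auto
  moreover have "ln (21/100 / v) = ln (21/100) - ln v"
    using v by (intro ln_divide_pos) auto
  moreover have "- ln (21/100) \<le> (158/100 :: real)"
  proof -
    have "ln (1 / (21/100 :: real)) \<le> ln (exp (158/100))"
      using exp_158_hundredths_ge by (subst ln_le_cancel_iff) auto
    then show ?thesis by (simp add: ln_div)
  qed
  ultimately have "- ln v \<le> 58/100 + 21/100 / v" by linarith
  then have "v * (- ln v) \<le> v * (58/100 + 21/100 / v)"
    using v by (intro mult_left_mono) auto
  also have "\<dots> = 58/100 * v + 21/100" using v by (simp add: field_simps)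
  finally have 1: "v * (- ln v) \<le> 58/100 * v + 21/100" .
  have "ln (1 / w) \<le> 1 / w - 1"
    using w by (intro ln_le_minus_one) auto
  then have "- ln w \<le> 1 / w - 1"
    using w by (simp add: ln_div)
  then have "w * (- ln w) \<le> w * (1 / w - 1)"
    using w(2) by (intro mult_left_mono) auto
  also have "\<dots> = v" using w(2) by (simp add: right_diff_distrib) (simp add: v_def)
  finally have 2: "- v \<le> w * ln w" by simp
  have "w * (693/1000) \<le> w * ln 2"
    using w(2) ln2_ge_693_thousandths by (intro mult_left_mono) auto
  moreover have "w * ln (2 * w) = w * ln 2 + w * ln w"
    using w(2) by (simp add: ln_mult_pos distrib_left)
  ultimately have "w * (693/1000) - v \<le> w * ln (2 * w)"
    using 2 by linarith
  moreover have "2 * (58/100 * v + 21/100) - 2 * (v * w) \<le> w * (693/1000) - v"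
  proof -
    have "v * v \<le> (21/100) * (21/100)"
      using v by (intro mult_mono) auto
    then show ?thesis using v unfolding w(1) by (simp add: algebra_simps)
  qed
  ultimately have "2 * (- ln v - w) * v \<le> w * ln (2 * w)"
    using 1 by (simp add: algebra_simps)
  then have "2 * (- ln v - w) / w \<le> ln (2 * w) / v"
    using v(1) w(2) by (simp add: divide_simps algebra_simps)
  then show ?thesis by (simp add: v_def)
qed

text \<open>
  The left-hand side is the blow-up time of the Bernoulli equation below in the time unit
  \<open>y 0 powr (- r) / c\<close>; the parameter \<open>w = - M 0 / (c * y 0 powr (1 + r))\<close> measures the initial
  energy.  Put \<open>L = - ln (1 - w)\<close>.  As \<open>ln (1 + 1/r) \<le> 1/r\<close>, the numerator is at most \<open>L + 1/r\<close>.
  If \<open>L \<le> 2 * w + 1/r\<close>, this is at most \<open>(2 / r) * (1 + r * w)\<close>, which gives the second entry of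
  the maximum.  Otherwise \<open>1/r < L - 2 * w\<close> bounds the numerator by \<open>2 * (L - w)\<close>
  independently of \<open>r\<close>, and \<open>w\<close> exceeds \<open>79/100\<close>.  Since \<open>w * (r + 1) \<le> 1 + r * w\<close> and
  \<open>(2 * w) powr (1 / (r + 1)) \<ge> 1 + ln (2 * w) / (r + 1)\<close>, the factor \<open>1 / (r + 1)\<close> cancels from
  the comparison with the first entry, and what remains is an inequality in \<open>w\<close> alone.
\<close>
lemma bernoulli_time_le_max:
  fixes r w :: real
  assumes r: "0 < r" and w: "0 \<le> w" "w < 1"
  shows "ln ((1 + 1/r) / (1 - w)) / (1 + r * w)
           \<le> max (((2 * w) powr (1 / (r + 1)) - 1) / (1 - w)) (2 / r)"
proof -
  define L where "L = - ln (1 - w)"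
  have "ln ((1 + 1/r) / (1 - w)) = ln (1 + 1/r) + L"
    using r w by (simp add: L_def ln_divide_pos add_pos_pos)
  then have num: "ln ((1 + 1/r) / (1 - w)) \<le> L + 1/r"
    using r ln_add_one_self_le_self[of "1/r"] by simp
  have den: "0 < 1 + r * w" using r w by (simp add: add_pos_nonneg)
  show ?thesis
  proof (cases "L \<le> 2 * w + 1/r")
    case True
    then have "ln ((1 + 1/r) / (1 - w)) \<le> (2 / r) * (1 + r * w)"
      using num r by (simp add: field_simps)
    then have "ln ((1 + 1/r) / (1 - w)) / (1 + r * w) \<le> 2 / r"
      using den by (simp only: pos_divide_le_eq)
    then show ?thesis by (rule max.coboundedI2)
  next
    case False
    have "0 < 1/r" using r by simp
    with False have "2 * w < - ln (1 - w)" unfolding L_def by linarith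
    then have w79: "79/100 < w" using gt_if_minus_ln_gt w by blast
    have "ln ((1 + 1/r) / (1 - w)) / (1 + r * w) \<le> 2 * (L - w) / (1 + r * w)"
      using num False den by (intro divide_right_mono) auto
    also have "\<dots> \<le> 2 * (L - w) / (w * (r + 1))"
    proof (intro divide_left_mono mult_pos_pos den)
      show "w * (r + 1) \<le> 1 + r * w" using w by (simp add: algebra_simps)
      have "w < L" using False w \<open>0 < 1/r\<close> by linarith
      then show "0 \<le> 2 * (L - w)" by simp
    qed (use w79 r in auto)
    also have "\<dots> = (1 / (r + 1)) * (2 * (L - w) / w)" by simp
    also have "\<dots> \<le> (1 / (r + 1)) * (ln (2 * w) / (1 - w))"
      using ln_comparison[OF w79 w(2)] r by (intro mult_left_mono) (auto simp: L_def)
    also have "\<dots> \<le> ((2 * w) powr (1 / (r + 1)) - 1) / (1 - w)"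
    proof -
      have "1 + (1 / (r + 1)) * ln (2 * w) \<le> exp ((1 / (r + 1)) * ln (2 * w))"
        by (rule exp_ge_add_one_self)
      also have "\<dots> = (2 * w) powr (1 / (r + 1))"
        using w79 by (simp add: powr_def)
      finally have "(1 / (r + 1)) * ln (2 * w) / (1 - w) \<le> ((2 * w) powr (1 / (r + 1)) - 1) / (1 - w)"
        using w by (intro divide_right_mono) auto
      then show ?thesis by simp
    qed
    finally show ?thesis by simp
  qed
qed

section \<open>Blow-up for growth with dissipation\<close>

text \<open>
  The function \<open>y\<close> stands for the squared \<open>L\<^sup>2\<close> norm of a solution, \<open>M\<close> for \<open>- 4\<close> times its
  energy, and \<open>r\<close> for \<open>(p - 1) / 2\<close>.  The assumption \<open>dissipation\<close> bounds the decay of the energy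
  from below by the growth of \<open>y\<close>; it is the Cauchy-Schwarz inequality for
  \<open>y' = 2 \<integral> u d/dt u\<close> and \<open>M' = 4 \<integral> (d/dt u)\<^sup>2\<close>.
\<close>
locale dissipative_growth =
  fixes y y' M M' :: "real \<Rightarrow> real" and c r \<tau> :: real
  assumes c_pos: "0 < c" and r_pos: "0 < r" and tau: "0 \<le> \<tau>"
    and cont_y: "continuous_on {0..\<tau>} y"
    and cont_M: "continuous_on {0..\<tau>} M"
    and deriv_y: "\<And>s. 0 < s \<Longrightarrow> s < \<tau> \<Longrightarrow> (y has_real_derivative y' s) (at s)"
    and deriv_M: "\<And>s. 0 < s \<Longrightarrow> s < \<tau> \<Longrightarrow> (M has_real_derivative M' s) (at s)"
    and growth: "\<And>s. 0 < s \<Longrightarrow> s < \<tau> \<Longrightarrow> c * y s powr (1 + r) + M s \<le> y' s"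
    and M'_nonneg: "\<And>s. 0 < s \<Longrightarrow> s < \<tau> \<Longrightarrow> 0 \<le> M' s"
    and dissipation: "\<And>s. 0 < s \<Longrightarrow> s < \<tau> \<Longrightarrow> (y' s)\<^sup>2 \<le> M' s * y s"
    and y_nonneg: "\<And>s. 0 \<le> s \<Longrightarrow> s \<le> \<tau> \<Longrightarrow> 0 \<le> y s"
    and init_y: "0 < y 0"
    and init_rate: "0 < c * y 0 powr (1 + r) + M 0"
begin

lemma M_ge: "M 0 \<le> M s" if s: "0 \<le> s" "s \<le> \<tau>"
proof (rule DERIV_nonneg_imp_increasing_open[OF s(1)])
  fix z assume "0 < z" "z < s"
  with s have "0 < z" "z < \<tau>" by auto
  then show "\<exists>d. (M has_real_derivative d) (at z) \<and> 0 \<le> d"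
    using deriv_M M'_nonneg by blast
next
  show "continuous_on {0..s} M"
    by (rule continuous_on_subset[OF cont_M]) (use s in auto)
qed

lemma y_ge_if_rate_pos:
  assumes s: "0 \<le> s" "s \<le> \<tau>"
    and rate: "\<And>z. 0 < z \<Longrightarrow> z < s \<Longrightarrow> 0 < c * y z powr (1 + r) + M z"
  shows "y 0 \<le> y s"
proof (rule DERIV_nonneg_imp_increasing_open[OF s(1)])
  fix z assume z: "0 < z" "z < s"
  then have "z < \<tau>" using s by simp
  moreover have "0 \<le> y' z"
    using growth[OF z(1) \<open>z < \<tau>\<close>] rate[OF z] by linarith
  ultimately show "\<exists>d. (y has_real_derivative d) (at z) \<and> 0 \<le> d"
    using deriv_y z by blast
next
  show "continuous_on {0..s} y"
    by (rule continuous_on_subset[OF cont_y]) (use s in auto)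
qed

text \<open>
  At the first zero of the rate, \<open>y\<close> and \<open>M\<close> would both be at least their initial values, because
  \<open>y\<close> increases as long as the rate is positive.  But the rate is increasing in \<open>y\<close> and \<open>M\<close> and is
  positive initially.
\<close>
lemma rate_pos: "0 < c * y s powr (1 + r) + M s" if s: "0 \<le> s" "s \<le> \<tau>"
proof (rule ccontr)
  define K where "K = (\<lambda>s. c * y s powr (1 + r) + M s)"
  have contK: "continuous_on {0..\<tau>} K"
    unfolding K_def using r_pos
    by (intro continuous_on_add continuous_on_mult continuous_on_const continuous_on_powr'
          cont_y cont_M) (auto simp: y_nonneg)
  assume neg: "\<not> ?thesis"
  have K0: "0 < K 0" using init_rate by (simp add: K_def)
  define S where "S = {0..s} \<inter> K -` {..0}"
  have "s \<in> S" using neg s by (auto simp: S_def K_def)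
  have "closed S" unfolding S_def
    using s by (intro continuous_closed_preimage continuous_on_subset[OF contK]) auto
  then have "compact S"
    by (auto simp: compact_eq_bounded_closed S_def intro: bounded_subset[of "{0..s}"])
  then obtain z where z: "z \<in> S" "\<And>x. x \<in> S \<Longrightarrow> z \<le> x"
    using compact_attains_inf[of S] \<open>s \<in> S\<close> by blast
  have zs: "0 \<le> z" "z \<le> s" "K z \<le> 0" using z(1) by (auto simp: S_def)
  have "y 0 \<le> y z"
  proof (rule y_ge_if_rate_pos)
    fix x assume "0 < x" "x < z"
    then show "0 < c * y x powr (1 + r) + M x"
      using z(2)[of x] zs by (force simp: S_def K_def)
  qed (use zs s in auto)
  then have "c * y 0 powr (1 + r) \<le> c * y z powr (1 + r)"
    using c_pos r_pos init_y by (intro mult_left_mono powr_mono2) auto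
  moreover have "M 0 \<le> M z" using zs s by (intro M_ge) auto
  ultimately have "K 0 \<le> K z" by (simp add: K_def)
  with K0 zs show False by simp
qed

lemma y_ge: "y 0 \<le> y s" if "0 \<le> s" "s \<le> \<tau>"
  using that by (intro y_ge_if_rate_pos rate_pos) auto

lemma y_pos: "0 < y s" if "0 \<le> s" "s \<le> \<tau>"
  using y_ge[OF that] init_y by simp

lemma y'_pos: "0 < y' s" if "0 < s" "s < \<tau>"
  using rate_pos[of s] growth[of s] that by simp

lemma continuous_y_powr: "continuous_on {0..\<tau>} (\<lambda>s. y s powr b)"
  using y_pos by (intro continuous_intros cont_y) force

lemma deriv_y_powr:
  assumes "0 < s" "s < \<tau>"
  shows "((\<lambda>s. y s powr b) has_real_derivative b * y s powr (b - 1) * y' s) (at s)"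
  using assms y_pos
  by (intro DERIV_chain2[OF has_real_derivative_powr] deriv_y) auto

text \<open>
  Here \<open>y' \<ge> c * y powr (1 + r)\<close>, so the positive function \<open>y powr (- r)\<close> decreases at rate at
  least \<open>r * c\<close>.
\<close>
lemma time_le_if_M_nonneg:
  assumes "0 \<le> M 0"
  shows "\<tau> \<le> y 0 powr (- r) / (r * c)"
proof -
  define Z where "Z = (\<lambda>s. - (y s powr (- r)) - r * c * s)"
  have "Z 0 \<le> Z \<tau>"
  proof (rule DERIV_nonneg_imp_increasing_open[OF tau])
    fix s assume s: "0 < s" "s < \<tau>"
    have ys: "0 < y s" using s y_pos[of s] by simp
    have "c * y s powr (1 + r) \<le> y' s"
      using growth[of s] M_ge[of s] assms s by simp
    then have "y s powr (- r - 1) * (c * y s powr (1 + r)) \<le> y s powr (- r - 1) * y' s"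
      by (intro mult_left_mono) auto
    moreover have "y s powr (- r - 1) * (c * y s powr (1 + r)) = c"
      using ys by (simp flip: powr_add)
    ultimately have "0 \<le> r * (y s powr (- r - 1) * y' s - c)"
      using r_pos by (intro mult_nonneg_nonneg) auto
    moreover have "(Z has_real_derivative - (- r * y s powr (- r - 1) * y' s) - r * c) (at s)"
      unfolding Z_def by (intro DERIV_diff DERIV_minus deriv_y_powr s DERIV_cmult_Id)
    ultimately show "\<exists>d. (Z has_real_derivative d) (at s) \<and> 0 \<le> d"
      by (intro exI) (auto simp: algebra_simps)
  next
    show "continuous_on {0..\<tau>} Z" unfolding Z_def
      by (intro continuous_intros continuous_y_powr)
  qed
  then have "r * c * \<tau> \<le> y 0 powr (- r) - y \<tau> powr (- r)"
    by (simp add: Z_def)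
  also have "\<dots> \<le> y 0 powr (- r)" by simp
  finally show ?thesis using r_pos c_pos by (simp add: field_simps)
qed

text \<open>
  Dissipation forces \<open>M\<close> to grow along with \<open>y\<close>: the function
  \<open>N = M / y - (c / r) * y powr r\<close> is nondecreasing, since \<open>M' * y \<ge> (y')\<^sup>2\<close> gives
  \<open>y\<^sup>2 * N' \<ge> y' * (y' - M - c * y powr (1 + r)) \<ge> 0\<close>.  The statement is \<open>N 0 \<le> N s\<close>
  multiplied by \<open>y s\<close>.
\<close>
lemma M_lower_bound:
  assumes s: "0 \<le> s" "s \<le> \<tau>"
  shows "c / r * y s powr (1 + r) - (c / r * y 0 powr r - M 0 / y 0) * y s \<le> M s"
proof -
  define N where "N = (\<lambda>s. M s / y s - c / r * y s powr r)"
  have "N 0 \<le> N s"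
  proof (rule DERIV_nonneg_imp_increasing_open[OF s(1)])
    fix z assume "0 < z" "z < s"
    then have z: "0 < z" "z < \<tau>" using s by auto
    have yz: "0 < y z" using z y_pos[of z] by simp
    let ?d = "(M' z * y z - M z * y' z) / (y z * y z) - c / r * (r * y z powr (r - 1) * y' z)"
    have "(N has_real_derivative ?d) (at z)"
      unfolding N_def using z yz
      by (auto intro!: derivative_eq_intros deriv_y_powr deriv_y deriv_M)
    moreover have "0 \<le> ?d"
    proof -
      have "0 \<le> y' z * (y' z - (c * y z powr (1 + r) + M z))"
        using y'_pos[of z] growth[of z] z by simp
      also have "\<dots> \<le> M' z * y z - M z * y' z - c * y z powr (1 + r) * y' z"
        using dissipation[of z] z by (simp add: power2_eq_square algebra_simps)
      also have "y z powr (1 + r) = y z powr (r - 1) * (y z * y z)"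
        using yz by (simp add: powr_add powr_diff)
      finally have "0 \<le> (M' z * y z - M z * y' z - c * (y z powr (r - 1) * (y z * y z)) * y' z)
                      / (y z * y z)"
        by simp
      also have "\<dots> = ?d" using yz r_pos by (simp add: field_simps)
      finally show ?thesis .
    qed
    ultimately show "\<exists>d. (N has_real_derivative d) (at z) \<and> 0 \<le> d" by blast
  next
    have "continuous_on {0..\<tau>} N" unfolding N_def
      using y_pos by (intro continuous_intros continuous_y_powr cont_y cont_M) force
    then show "continuous_on {0..s} N" by (rule continuous_on_subset) (use s in auto)
  qed
  then have "N 0 * y s \<le> N s * y s"
    using y_pos[OF s] by (intro mult_right_mono) auto
  then show ?thesis
    using y_pos[OF s] by (simp add: N_def algebra_simps powr_add)
qed

text \<open>
  Adding the lower bound on \<open>M\<close> to the growth inequality gives the Bernoulli inequality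
  \<open>y' \<ge> \<alpha> * y powr (1 + r) - \<gamma> * y\<close>.  It is linear in \<open>y powr (- r)\<close>, so
  \<open>\<alpha> - \<gamma> * y powr (- r)\<close>, which stays below \<open>\<alpha>\<close>, grows at least like \<open>exp (r * \<gamma> * s)\<close>.
\<close>
lemma time_le_if_M_nonpos:
  assumes M0: "M 0 \<le> 0"
  defines "w \<equiv> - M 0 / (c * y 0 powr (1 + r))"
  shows "\<tau> \<le> y 0 powr (- r) / c * (ln ((1 + 1/r) / (1 - w)) / (1 + r * w))"
proof -
  define \<alpha> where "\<alpha> = c * (1 + 1/r)"
  define \<gamma> where "\<gamma> = c / r * y 0 powr r - M 0 / y 0"
  define E where "E = (\<lambda>s. (\<alpha> - \<gamma> * y s powr (- r)) * exp (- (r * \<gamma>) * s))"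
  have y0: "0 < y 0 powr b" for b using init_y by simp
  have P: "0 < c * y 0 powr (1 + r)" using c_pos y0 by (intro mult_pos_pos)
  have w: "0 \<le> w"
    unfolding w_def using M0 P by (intro divide_nonneg_pos) auto
  have "w < 1"
    unfolding w_def pos_divide_less_eq[OF P] using init_rate by simp
  note w = w this
  have "M 0 / y 0 \<le> 0" "0 < c / r * y 0 powr r"
    using M0 init_y c_pos r_pos y0 by (auto intro: divide_nonpos_pos)
  then have c1: "0 < \<gamma>" "0 < \<alpha>"
    using c_pos r_pos by (auto simp: \<gamma>_def \<alpha>_def intro!: mult_pos_pos add_pos_pos)
  have \<gamma>_eq: "r * \<gamma> = c * y 0 powr r * (1 + r * w)"
    using r_pos c_pos init_y by (simp add: \<gamma>_def w_def powr_add field_simps)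
  have E0: "\<alpha> - \<gamma> * y 0 powr (- r) = c * (1 - w)"
    using r_pos c_pos init_y
    by (simp add: \<alpha>_def \<gamma>_def w_def powr_add powr_minus field_simps)
  have "E 0 \<le> E \<tau>"
  proof (rule DERIV_nonneg_imp_increasing_open[OF tau])
    fix s assume s: "0 < s" "s < \<tau>"
    have ys: "0 < y s" using s y_pos[of s] by simp
    let ?d = "(0 - \<gamma> * (- r * y s powr (- r - 1) * y' s)) * exp (- (r * \<gamma>) * s)
                + exp (- (r * \<gamma>) * s) * (- (r * \<gamma>)) * (\<alpha> - \<gamma> * y s powr (- r))"
    have "(E has_real_derivative ?d) (at s)"
      unfolding E_def
      by (intro DERIV_mult DERIV_diff DERIV_const DERIV_cmult deriv_y_powr s DERIV_fun_exp DERIV_cmult_Id)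
    moreover have "0 \<le> ?d"
    proof -
      have "\<alpha> * y s powr (1 + r) - \<gamma> * y s \<le> y' s"
        using growth[of s] M_lower_bound[of s] s by (simp add: \<alpha>_def \<gamma>_def algebra_simps)
      then have "y s powr (- r - 1) * (\<alpha> * y s powr (1 + r) - \<gamma> * y s) \<le> y s powr (- r - 1) * y' s"
        by (intro mult_left_mono) auto
      moreover have "y s powr (- r - 1) * (\<alpha> * y s powr (1 + r) - \<gamma> * y s)
          = \<alpha> - \<gamma> * y s powr (- r)"
        using ys by (simp add: powr_add powr_minus powr_diff field_simps)
      ultimately have "0 \<le> r * \<gamma> * exp (- (r * \<gamma>) * s)
          * (y s powr (- r - 1) * y' s - (\<alpha> - \<gamma> * y s powr (- r)))"
        using r_pos c1 by (intro mult_nonneg_nonneg) auto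
      also have "\<dots> = ?d" by (simp add: algebra_simps)
      finally show ?thesis .
    qed
    ultimately show "\<exists>d. (E has_real_derivative d) (at s) \<and> 0 \<le> d" by blast
  next
    show "continuous_on {0..\<tau>} E" unfolding E_def
      by (intro continuous_intros continuous_y_powr)
  qed
  then have "c * (1 - w) \<le> (\<alpha> - \<gamma> * y \<tau> powr (- r)) * exp (- (r * \<gamma>) * \<tau>)"
    using E0 by (simp add: E_def)
  also have "\<dots> \<le> \<alpha> * exp (- (r * \<gamma>) * \<tau>)"
    using c1 by (intro mult_right_mono) auto
  also have "\<dots> = c * ((1 + 1/r) / exp (r * \<gamma> * \<tau>))"
    by (simp add: \<alpha>_def exp_minus divide_inverse)
  finally have "1 - w \<le> (1 + 1/r) / exp (r * \<gamma> * \<tau>)"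
    using c_pos by (simp only: mult_le_cancel_left_pos)
  then have "exp (r * \<gamma> * \<tau>) \<le> (1 + 1/r) / (1 - w)"
    using w by (simp add: pos_le_divide_eq mult.commute)
  then have "r * \<gamma> * \<tau> \<le> ln ((1 + 1/r) / (1 - w))"
    using w r_pos by (subst ln_ge_iff) (auto intro!: divide_pos_pos add_pos_pos)
  then have "\<tau> \<le> ln ((1 + 1/r) / (1 - w)) / (r * \<gamma>)"
    using c1 r_pos by (simp add: pos_le_divide_eq mult.commute)
  also have "\<dots> = y 0 powr (- r) / c * (ln ((1 + 1/r) / (1 - w)) / (1 + r * w))"
    unfolding \<gamma>_eq by (simp add: powr_minus divide_inverse mult_ac)
  finally show ?thesis .
qed

end

section \<open>Powers and weighted sums\<close>

text \<open>
  The point of interest is \<open>0\<close>, where the difference quotient is bounded by \<open>\<bar>h\<bar> powr p\<close>.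
\<close>
lemma has_real_derivative_abs_powr:
  fixes x p :: real
  assumes "1 < p"
  shows "((\<lambda>x. \<bar>x\<bar> powr (p + 1)) has_real_derivative (p + 1) * (\<bar>x\<bar> powr (p - 1) * x)) (at x)"
proof (cases "x = 0")
  case True
  have "((\<lambda>h::real. \<bar>h\<bar> powr p) \<longlongrightarrow> \<bar>0\<bar> powr p) (at 0)"
    using assms by (intro tendsto_powr' tendsto_intros) auto
  then have "((\<lambda>h::real. \<bar>h\<bar> powr p) \<longlongrightarrow> 0) (at 0)" by simp
  then have "((\<lambda>h::real. (\<bar>h\<bar> powr (p + 1) - 0) / h) \<longlongrightarrow> 0) (at 0)"
  proof (rule tendsto_0_le[where K = 1])
    show "\<forall>\<^sub>F h::real in at 0. norm ((\<bar>h\<bar> powr (p + 1) - 0) / h) \<le> norm (\<bar>h\<bar> powr p) * 1"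
      by (auto simp: eventually_at_filter powr_add)
  qed
  then show ?thesis using True by (simp add: DERIV_def)
next
  case False
  have "((\<lambda>x. \<bar>x\<bar>) has_real_derivative sgn x) (at x)"
  proof (cases "0 < x")
    case True
    then show ?thesis
      by (auto intro: has_field_derivative_transform_within_open[OF DERIV_ident, of "{0<..}"])
  next
    case neg: False
    then show ?thesis using False
      by (auto intro: has_field_derivative_transform_within_open[OF DERIV_minus[OF DERIV_ident], of "{..<0}"])
  qed
  then have "((\<lambda>x. \<bar>x\<bar> powr (p + 1)) has_real_derivative (p + 1) * \<bar>x\<bar> powr (p + 1 - 1) * sgn x) (at x)"
    using False by (intro DERIV_chain2[where g = abs, OF has_real_derivative_powr]) auto
  moreover have "(p + 1) * \<bar>x\<bar> powr (p + 1 - 1) * sgn x = (p + 1) * (\<bar>x\<bar> powr (p - 1) * x)"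
    using False by (cases "x > 0") (auto simp: powr_diff)
  ultimately show ?thesis by (simp only:)
qed

text \<open>
  Jensen's inequality for the power \<open>q\<close>.  It follows by summing the tangent-line bound at the mean
  value \<open>b\<close>, which in the form of Young's inequality also covers the value \<open>0\<close> of \<open>f\<close> or of \<open>b\<close>.
\<close>
lemma powr_mean_le:
  fixes m f :: "'b \<Rightarrow> real" and q :: real
  assumes q: "1 < q"
    and m: "\<And>x. x \<in> A \<Longrightarrow> 0 \<le> m x" and f: "\<And>x. x \<in> A \<Longrightarrow> 0 \<le> f x"
    and vol: "0 < (\<Sum>x\<in>A. m x)"
  shows "(\<Sum>x\<in>A. m x) powr (1 - q) * (\<Sum>x\<in>A. m x * f x) powr q \<le> (\<Sum>x\<in>A. m x * f x powr q)"
proof -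
  define W where "W = (\<Sum>x\<in>A. m x)"
  define S where "S = (\<Sum>x\<in>A. m x * f x)"
  define b where "b = S / W"
  have W: "0 < W" and S: "0 \<le> S"
    using vol m f by (auto simp: W_def S_def intro: sum_nonneg)
  then have b: "0 \<le> b" and Sb: "S = W * b" by (auto simp: b_def)
  have bq: "b * b powr (q - 1) = b powr q"
    using b by (cases "b = 0") (auto simp: powr_diff)
  have "S * b powr (q - 1) = (\<Sum>x\<in>A. m x * (f x * b powr (q - 1)))"
    by (simp add: S_def sum_distrib_right mult.assoc)
  also have "\<dots> \<le> (\<Sum>x\<in>A. m x * (f x powr q / q + (1 - 1 / q) * b powr q))"
  proof (intro sum_mono mult_left_mono m)
    fix x assume x: "x \<in> A"
    have "f x * b powr (q - 1) \<le> f x powr q / q + (b powr (q - 1)) powr (q / (q - 1)) / (q / (q - 1))"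
      using q f[OF x] by (intro Youngs_inequality) (auto simp: field_simps)
    also have "\<dots> = f x powr q / q + (1 - 1 / q) * b powr q"
    proof -
      have "(b powr (q - 1)) powr (q / (q - 1)) = b powr q"
        using q by (simp add: powr_powr)
      then show ?thesis using q by (simp add: field_simps)
    qed
    finally show "f x * b powr (q - 1) \<le> f x powr q / q + (1 - 1 / q) * b powr q" .
  qed
  also have "\<dots> = (\<Sum>x\<in>A. m x * f x powr q) / q + (1 - 1 / q) * (W * b powr q)"
    by (simp add: W_def sum.distrib distrib_left sum_divide_distrib sum_distrib_left sum_distrib_right mult_ac)
  finally have "W * b powr q \<le> (\<Sum>x\<in>A. m x * f x powr q) / q + (1 - 1 / q) * (W * b powr q)"
    by (simp add: Sb mult.assoc bq)
  then have "W * b powr q / q \<le> (\<Sum>x\<in>A. m x * f x powr q) / q"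
    by (simp add: left_diff_distrib)
  then have "W * b powr q \<le> (\<Sum>x\<in>A. m x * f x powr q)"
    using q by (simp add: divide_le_cancel)
  moreover have "W powr (1 - q) * S powr q = W * b powr q"
    using W S by (simp add: b_def powr_divide powr_diff)
  ultimately show ?thesis by (simp add: W_def S_def)
qed

lemma weighted_Cauchy_Schwarz:
  fixes m f g :: "'b \<Rightarrow> real"
  assumes "\<And>x. x \<in> A \<Longrightarrow> 0 \<le> m x"
  shows "(\<Sum>x\<in>A. m x * (f x * g x))\<^sup>2 \<le> (\<Sum>x\<in>A. m x * (g x)\<^sup>2) * (\<Sum>x\<in>A. m x * (f x)\<^sup>2)"
proof -
  have "(\<Sum>x\<in>A. m x * (f x * g x)) = (\<Sum>x\<in>A. (sqrt (m x) * g x) * (sqrt (m x) * f x))"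
    using assms by (intro sum.cong) (auto simp: algebra_simps)
  moreover have "(\<Sum>x\<in>A. m x * (h x)\<^sup>2) = (\<Sum>x\<in>A. (sqrt (m x) * h x)\<^sup>2)" for h :: "'b \<Rightarrow> real"
    using assms by (intro sum.cong) (auto simp: power_mult_distrib)
  ultimately show ?thesis by (simp only: Cauchy_Schwarz_ineq_sum)
qed

section \<open>Mass and energy along the heat flow\<close>

definition reaction_diffusion ::
    "'a pair_pre_digraph \<Rightarrow> ('a \<Rightarrow> real) \<Rightarrow> ('a \<Rightarrow> 'a \<Rightarrow> real) \<Rightarrow> real \<Rightarrow> ('a \<Rightarrow> real)
      \<Rightarrow> ('a \<Rightarrow> real) \<Rightarrow> 'a \<Rightarrow> real" where
  "reaction_diffusion G \<mu> \<omega> p a f x =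
     laplacian G \<mu> \<omega> f x - a x * f x + \<bar>f x\<bar> powr (p - 1) * f x"

context weighted_graph
begin

text \<open>
  Extending the weights by \<open>0\<close> to all pairs of vertices lets the sums over neighbours be
  interchanged.
\<close>
definition conductance :: "'a \<Rightarrow> 'a \<Rightarrow> real" where
  "conductance x y = (if x \<rightarrow>\<^bsub>with_proj G\<^esub> y then \<omega> x y else 0)"

lemma conductance_sym: "conductance x y = conductance y x"
proof -
  have "x \<rightarrow>\<^bsub>with_proj G\<^esub> y \<longleftrightarrow> y \<rightarrow>\<^bsub>with_proj G\<^esub> x"
    using sym_arcs unfolding symmetric_def sym_def by blast
  then show ?thesis using weight_sym[of x y] by (auto simp: conductance_def)
qed

lemma sum_neighbours:
  "(\<Sum>y | x \<rightarrow>\<^bsub>with_proj G\<^esub> y. \<omega> x y * f y) = (\<Sum>y\<in>pverts G. conductance x y * f y)"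
proof (rule sum.mono_neutral_cong_left)
  show "{y. x \<rightarrow>\<^bsub>with_proj G\<^esub> y} \<subseteq> pverts G"
    using adj_in_verts(2) by auto
qed (auto simp: conductance_def)

definition dirichlet_form :: "('a \<Rightarrow> real) \<Rightarrow> ('a \<Rightarrow> real) \<Rightarrow> real" where
  "dirichlet_form f g =
     1 / 2 * (\<Sum>x\<in>pverts G. \<Sum>y\<in>pverts G. conductance x y * ((f y - f x) * (g y - g x)))"

lemma vintegral_grad_sq: "vintegral G \<mu> (grad_sq G \<mu> \<omega> f) = dirichlet_form f f"
proof -
  have "\<mu> x * grad_sq G \<mu> \<omega> f x
      = 1 / 2 * (\<Sum>y\<in>pverts G. conductance x y * ((f y - f x) * (f y - f x)))"
    if "x \<in> pverts G" for x
    using measure_pos[OF that] unfolding grad_sq_def sum_neighbours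
    by (simp add: power2_eq_square)
  then show ?thesis
    by (simp add: vintegral_def dirichlet_form_def sum_distrib_left cong: sum.cong)
qed

text \<open>
  Green's formula: interchanging the two summation variables changes the sign of the difference, so
  averaging the double sum with its interchanged copy produces both differences.
\<close>
lemma green: "vintegral G \<mu> (\<lambda>x. g x * laplacian G \<mu> \<omega> f x) = - dirichlet_form f g"
proof -
  define S where "S = (\<Sum>x\<in>pverts G. \<Sum>y\<in>pverts G. conductance x y * ((f y - f x) * g x))"
  have "\<mu> x * (g x * laplacian G \<mu> \<omega> f x)
      = (\<Sum>y\<in>pverts G. conductance x y * ((f y - f x) * g x))" if "x \<in> pverts G" for x
    using measure_pos[OF that] unfolding laplacian_def sum_neighbours
    by (simp add: sum_distrib_left mult_ac)
  then have lhs: "vintegral G \<mu> (\<lambda>x. g x * laplacian G \<mu> \<omega> f x) = S"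
    by (simp add: vintegral_def S_def cong: sum.cong)
  define S' where "S' = (\<Sum>x\<in>pverts G. \<Sum>y\<in>pverts G. conductance x y * ((f x - f y) * g y))"
  have "S = (\<Sum>x\<in>pverts G. \<Sum>y\<in>pverts G. conductance y x * ((f x - f y) * g y))"
    unfolding S_def by (rule sum.swap)
  also have "\<dots> = S'"
    unfolding S'_def by (intro sum.cong refl) (simp add: conductance_sym)
  finally have "S = S'" .
  moreover have "S + S' = (\<Sum>x\<in>pverts G. \<Sum>y\<in>pverts G.
      - (conductance x y * ((f y - f x) * (g y - g x))))"
    unfolding S_def S'_def sum.distrib[symmetric]
    by (intro sum.cong refl) (simp add: algebra_simps)
  ultimately have "S + S = - (2 * dirichlet_form f g)"
    by (simp add: dirichlet_form_def sum_negf)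
  then show ?thesis using lhs by simp
qed

lemma energy_eq:
  "energy G \<mu> \<omega> p a f = 1 / 2 * (dirichlet_form f f + (\<Sum>x\<in>pverts G. \<mu> x * (a x * (f x)\<^sup>2)))
     - 1 / (p + 1) * (\<Sum>x\<in>pverts G. \<mu> x * \<bar>f x\<bar> powr (p + 1))"
  using vintegral_grad_sq[of f]
  by (simp add: energy_def vintegral_def distrib_left sum.distrib)

text \<open>
  For a solution the left-hand side is the derivative of \<open>\<integral> u\<^sup>2\<close>.  The quadratic terms are absorbed
  into the energy; the part of the power term that is left has a positive factor because \<open>p > 1\<close>.
\<close>
lemma vintegral_mult_reaction_diffusion:
  assumes "1 < p"
  shows "2 * vintegral G \<mu> (\<lambda>x. f x * reaction_diffusion G \<mu> \<omega> p a f x)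
    = - 4 * energy G \<mu> \<omega> p a f
      + 2 * (p - 1) / (p + 1) * vintegral G \<mu> (\<lambda>x. \<bar>f x\<bar> powr (p + 1))"
proof -
  have pw: "z * (\<bar>z\<bar> powr (p - 1) * z) = \<bar>z\<bar> powr (p + 1)" for z :: real
  proof (cases "z = 0")
    case False
    have "\<bar>z\<bar> powr (p + 1) = \<bar>z\<bar> powr ((p - 1) + 2)" by (simp add: add.commute)
    also have "\<dots> = \<bar>z\<bar> powr (p - 1) * z\<^sup>2"
      using False by (subst powr_add) (simp add: powr_numeral)
    finally show ?thesis by (simp only: power2_eq_square mult_ac)
  qed auto
  have "f x * reaction_diffusion G \<mu> \<omega> p a f x
      = f x * laplacian G \<mu> \<omega> f x - a x * (f x)\<^sup>2 + \<bar>f x\<bar> powr (p + 1)" for x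
    unfolding reaction_diffusion_def distrib_left right_diff_distrib pw
    by (simp add: power2_eq_square)
  then have "vintegral G \<mu> (\<lambda>x. f x * reaction_diffusion G \<mu> \<omega> p a f x)
      = - dirichlet_form f f - (\<Sum>x\<in>pverts G. \<mu> x * (a x * (f x)\<^sup>2))
        + (\<Sum>x\<in>pverts G. \<mu> x * \<bar>f x\<bar> powr (p + 1))"
    using green[of f f]
    by (simp add: vintegral_def distrib_left right_diff_distrib sum.distrib sum_subtractf)
  moreover have "2 * (p - 1) / (p + 1) = 2 - 4 * (1 / (p + 1))"
    using assms by (simp add: field_simps)
  ultimately show ?thesis
    by (simp only: energy_eq vintegral_def) (simp add: algebra_simps)
qed

lemma mass_has_derivative:
  assumes "\<And>x. x \<in> pverts G \<Longrightarrow> (U x has_real_derivative V x) (at t)"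
  shows "((\<lambda>s. vintegral G \<mu> (\<lambda>x. (U x s)\<^sup>2)) has_real_derivative
    2 * vintegral G \<mu> (\<lambda>x. U x t * V x)) (at t)"
  unfolding vintegral_def
  by (auto intro!: derivative_eq_intros assms sum.cong simp: sum_distrib_left)

text \<open>
  The heat equation is the gradient flow of the energy with respect to the measure \<open>\<mu>\<close>.
\<close>
lemma energy_has_derivative:
  assumes "1 < p" and U: "\<And>x. x \<in> pverts G \<Longrightarrow> (U x has_real_derivative V x) (at t)"
  shows "((\<lambda>s. energy G \<mu> \<omega> p a (\<lambda>x. U x s)) has_real_derivative
    - vintegral G \<mu> (\<lambda>x. V x * reaction_diffusion G \<mu> \<omega> p a (\<lambda>y. U y t) x)) (at t)"
proof -
  have "((\<lambda>s. dirichlet_form (\<lambda>x. U x s) (\<lambda>x. U x s)) has_real_derivative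
      2 * dirichlet_form (\<lambda>x. U x t) V) (at t)"
    unfolding dirichlet_form_def
    by (auto intro!: derivative_eq_intros U sum.cong simp: sum_distrib_left algebra_simps)
  moreover have "((\<lambda>s. \<Sum>x\<in>pverts G. \<mu> x * (a x * (U x s)\<^sup>2)) has_real_derivative
      2 * (\<Sum>x\<in>pverts G. \<mu> x * (V x * (a x * U x t)))) (at t)"
    by (auto intro!: derivative_eq_intros U sum.cong simp: sum_distrib_left)
  moreover have "((\<lambda>s. \<Sum>x\<in>pverts G. \<mu> x * \<bar>U x s\<bar> powr (p + 1)) has_real_derivative
      (p + 1) * (\<Sum>x\<in>pverts G. \<mu> x * (V x * (\<bar>U x t\<bar> powr (p - 1) * U x t)))) (at t)"
  proof -
    have "((\<lambda>s. \<Sum>x\<in>pverts G. \<mu> x * \<bar>U x s\<bar> powr (p + 1)) has_real_derivative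
        (\<Sum>x\<in>pverts G. \<mu> x * ((p + 1) * (\<bar>U x t\<bar> powr (p - 1) * U x t) * V x))) (at t)"
      by (intro DERIV_sum DERIV_cmult
            DERIV_chain2[where f = "\<lambda>z. \<bar>z\<bar> powr (p + 1)", OF has_real_derivative_abs_powr] assms)
    then show ?thesis by (simp add: sum_distrib_left mult_ac)
  qed
  ultimately have D: "((\<lambda>s. energy G \<mu> \<omega> p a (\<lambda>x. U x s)) has_real_derivative
      1 / 2 * (2 * dirichlet_form (\<lambda>x. U x t) V + 2 * (\<Sum>x\<in>pverts G. \<mu> x * (V x * (a x * U x t))))
      - 1 / (p + 1) * ((p + 1) * (\<Sum>x\<in>pverts G. \<mu> x * (V x * (\<bar>U x t\<bar> powr (p - 1) * U x t))))) (at t)"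
    unfolding energy_eq
    by (intro DERIV_diff DERIV_add DERIV_cmult)
  have eq: "vintegral G \<mu> (\<lambda>x. V x * reaction_diffusion G \<mu> \<omega> p a (\<lambda>y. U y t) x)
     = - dirichlet_form (\<lambda>x. U x t) V - (\<Sum>x\<in>pverts G. \<mu> x * (V x * (a x * U x t)))
       + (\<Sum>x\<in>pverts G. \<mu> x * (V x * (\<bar>U x t\<bar> powr (p - 1) * U x t)))"
    using green[of V "\<lambda>x. U x t"]
    by (simp add: reaction_diffusion_def vintegral_def distrib_left right_diff_distrib
          sum.distrib sum_subtractf)
  show ?thesis
    by (rule DERIV_cong[OF D]) (use \<open>1 < p\<close> in \<open>simp add: eq add_divide_distrib\<close>)
qed

lemma continuous_energy:
  assumes "1 < p" and U: "\<And>x. x \<in> pverts G \<Longrightarrow> continuous_on A (U x)"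
  shows "continuous_on A (\<lambda>s. energy G \<mu> \<omega> p a (\<lambda>x. U x s))"
  unfolding energy_eq dirichlet_form_def
  using assms(1) by (intro continuous_intros continuous_on_powr' U) auto

lemma vvolume_powr_le:
  assumes "1 < p" "0 < vvolume G \<mu>"
  shows "vvolume G \<mu> powr ((1 - p) / 2) * vintegral G \<mu> (\<lambda>x. (f x)\<^sup>2) powr ((p + 1) / 2)
    \<le> vintegral G \<mu> (\<lambda>x. \<bar>f x\<bar> powr (p + 1))"
proof -
  have sq: "((f x)\<^sup>2) powr ((p + 1) / 2) = \<bar>f x\<bar> powr (p + 1)" for x
  proof -
    have "(f x)\<^sup>2 = \<bar>f x\<bar> powr 2" by (simp add: powr_numeral)
    moreover have "2 * ((p + 1) / 2) = p + 1" by simp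
    ultimately show ?thesis by (simp only: powr_powr)
  qed
  have eq: "1 - (p + 1) / 2 = (1 - p) / 2" by (simp add: field_simps)
  have "(\<Sum>x\<in>pverts G. \<mu> x) powr (1 - (p + 1) / 2) * (\<Sum>x\<in>pverts G. \<mu> x * (f x)\<^sup>2) powr ((p + 1) / 2)
      \<le> (\<Sum>x\<in>pverts G. \<mu> x * ((f x)\<^sup>2) powr ((p + 1) / 2))"
    using assms measure_pos
    by (intro powr_mean_le) (auto simp: vvolume_def vintegral_def less_imp_le)
  then show ?thesis
    unfolding vintegral_def vvolume_def sq eq by simp
qed

text \<open>
  The growth inequality combines the identity for \<open>\<integral> u\<^sup>2\<close> with Jensen's inequality; the two
  assumptions on \<open>M'\<close> come from the gradient flow structure and from Cauchy-Schwarz.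
\<close>
lemma dissipative_growth_of_solution:
  fixes U :: "'a \<Rightarrow> real \<Rightarrow> real" and p \<tau> :: real and a :: "'a \<Rightarrow> real"
  defines "F \<equiv> \<lambda>s. reaction_diffusion G \<mu> \<omega> p a (\<lambda>y. U y s)"
    and "c \<equiv> 2 * (p - 1) / (p + 1) * vvolume G \<mu> powr ((1 - p) / 2)"
    and "y0 \<equiv> vintegral G \<mu> (\<lambda>x. (U x 0)\<^sup>2)"
  assumes p: "1 < p" and tau: "0 \<le> \<tau>" and vol: "0 < vvolume G \<mu>"
    and cont: "\<And>x. x \<in> pverts G \<Longrightarrow> continuous_on {0..\<tau>} (U x)"
    and deriv: "\<And>x s. x \<in> pverts G \<Longrightarrow> 0 < s \<Longrightarrow> s < \<tau> \<Longrightarrow> (U x has_real_derivative F s x) (at s)"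
    and y0: "0 < y0"
    and init: "4 * energy G \<mu> \<omega> p a (\<lambda>x. U x 0) < c * y0 powr ((p + 1) / 2)"
  shows "dissipative_growth
    (\<lambda>s. vintegral G \<mu> (\<lambda>x. (U x s)\<^sup>2)) (\<lambda>s. 2 * vintegral G \<mu> (\<lambda>x. U x s * F s x))
    (\<lambda>s. - 4 * energy G \<mu> \<omega> p a (\<lambda>x. U x s)) (\<lambda>s. 4 * vintegral G \<mu> (\<lambda>x. (F s x)\<^sup>2))
    c ((p - 1) / 2) \<tau>"
proof
  have r: "1 + (p - 1) / 2 = (p + 1) / 2" by (simp add: field_simps)
  have \<mu>: "0 \<le> \<mu> x" if "x \<in> pverts G" for x using measure_pos[OF that] by simp
  show "0 < c" using p vol by (simp add: c_def)
  show "0 < (p - 1) / 2" using p by simp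
  show "0 \<le> \<tau>" by (rule tau)
  show "continuous_on {0..\<tau>} (\<lambda>s. vintegral G \<mu> (\<lambda>x. (U x s)\<^sup>2))"
    unfolding vintegral_def by (intro continuous_intros cont)
  show "continuous_on {0..\<tau>} (\<lambda>s. - 4 * energy G \<mu> \<omega> p a (\<lambda>x. U x s))"
    by (intro continuous_intros continuous_energy p cont)
  show "0 < vintegral G \<mu> (\<lambda>x. (U x 0)\<^sup>2)" using y0 by (simp add: y0_def)
  show "0 < c * vintegral G \<mu> (\<lambda>x. (U x 0)\<^sup>2) powr (1 + (p - 1) / 2)
      + - 4 * energy G \<mu> \<omega> p a (\<lambda>x. U x 0)"
    using init unfolding r y0_def by simp
  fix s assume s: "0 < s" "s < \<tau>"
  show "((\<lambda>s. vintegral G \<mu> (\<lambda>x. (U x s)\<^sup>2)) has_real_derivative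
      2 * vintegral G \<mu> (\<lambda>x. U x s * F s x)) (at s)"
    by (rule mass_has_derivative[OF deriv[OF _ s]])
  have "((\<lambda>s. energy G \<mu> \<omega> p a (\<lambda>x. U x s)) has_real_derivative
      - vintegral G \<mu> (\<lambda>x. (F s x)\<^sup>2)) (at s)"
    using energy_has_derivative[where a = a and U = U, OF p deriv[OF _ s]]
    by (simp add: F_def power2_eq_square)
  from DERIV_cmult[OF this, of "- 4"]
  show "((\<lambda>s. - 4 * energy G \<mu> \<omega> p a (\<lambda>x. U x s)) has_real_derivative
      4 * vintegral G \<mu> (\<lambda>x. (F s x)\<^sup>2)) (at s)"
    by simp
  show "c * vintegral G \<mu> (\<lambda>x. (U x s)\<^sup>2) powr (1 + (p - 1) / 2)
      + - 4 * energy G \<mu> \<omega> p a (\<lambda>x. U x s) \<le> 2 * vintegral G \<mu> (\<lambda>x. U x s * F s x)"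
  proof -
    have "2 * (p - 1) / (p + 1) * (vvolume G \<mu> powr ((1 - p) / 2)
          * vintegral G \<mu> (\<lambda>x. (U x s)\<^sup>2) powr ((p + 1) / 2))
        \<le> 2 * (p - 1) / (p + 1) * vintegral G \<mu> (\<lambda>x. \<bar>U x s\<bar> powr (p + 1))"
      using p by (intro mult_left_mono vvolume_powr_le vol) auto
    then show ?thesis
      unfolding F_def vintegral_mult_reaction_diffusion[OF p] r c_def
      by (simp only: mult.assoc)
  qed
  show "0 \<le> 4 * vintegral G \<mu> (\<lambda>x. (F s x)\<^sup>2)"
    using \<mu> by (auto simp: vintegral_def intro!: sum_nonneg)
  have "(vintegral G \<mu> (\<lambda>x. U x s * F s x))\<^sup>2
      \<le> vintegral G \<mu> (\<lambda>x. (F s x)\<^sup>2) * vintegral G \<mu> (\<lambda>x. (U x s)\<^sup>2)"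
    unfolding vintegral_def by (rule weighted_Cauchy_Schwarz[OF \<mu>])
  then show "(2 * vintegral G \<mu> (\<lambda>x. U x s * F s x))\<^sup>2
      \<le> 4 * vintegral G \<mu> (\<lambda>x. (F s x)\<^sup>2) * vintegral G \<mu> (\<lambda>x. (U x s)\<^sup>2)"
    by (simp add: power_mult_distrib)
next
  fix s
  show "0 \<le> vintegral G \<mu> (\<lambda>x. (U x s)\<^sup>2)"
    unfolding vintegral_def
    by (intro sum_nonneg mult_nonneg_nonneg less_imp_le[OF measure_pos] zero_le_power2)
qed

lemma energy_cong:
  assumes "\<And>x. x \<in> pverts G \<Longrightarrow> f x = g x"
  shows "energy G \<mu> \<omega> p a f = energy G \<mu> \<omega> p a g"
  using assms by (simp add: energy_eq dirichlet_form_def cong: sum.cong)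

lemma mass_pos_of_energy_neg:
  assumes "energy G \<mu> \<omega> p a f < 0"
  shows "0 < vintegral G \<mu> (\<lambda>x. (f x)\<^sup>2)"
proof (rule ccontr)
  have nonneg: "0 \<le> \<mu> x * (f x)\<^sup>2" if "x \<in> pverts G" for x
    using measure_pos[OF that] by simp
  assume "\<not> ?thesis"
  moreover have "0 \<le> (\<Sum>x\<in>pverts G. \<mu> x * (f x)\<^sup>2)"
    by (rule sum_nonneg) (rule nonneg)
  ultimately have "(\<Sum>x\<in>pverts G. \<mu> x * (f x)\<^sup>2) = 0"
    unfolding vintegral_def by linarith
  then have "f x = 0" if "x \<in> pverts G" for x
    using that measure_pos[OF that] sum_nonneg_eq_0_iff[OF pair_finite_verts nonneg] by force
  then have "energy G \<mu> \<omega> p a f = energy G \<mu> \<omega> p a (\<lambda>x. 0)"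
    by (rule energy_cong)
  also have "\<dots> = 0" by (simp add: energy_eq dirichlet_form_def)
  finally show False using assms by simp
qed

lemma volume_pos_of_mass_pos:
  assumes "0 < vintegral G \<mu> (\<lambda>x. (f x)\<^sup>2)"
  shows "0 < vvolume G \<mu>"
proof -
  have "pverts G \<noteq> {}" using assms by (auto simp: vintegral_def)
  then show ?thesis
    using measure_pos by (auto simp: vvolume_def vintegral_def intro!: sum_pos)
qed

text \<open>
  Of the four functions only \<open>y 0\<close> and \<open>M 0\<close> enter the bounds on \<open>\<tau>\<close>, which is why they are
  hidden behind an existential.
\<close>
lemma dissipative_growth_of_is_solution:
  fixes u0 a :: "'a \<Rightarrow> real" and p \<tau> :: real
  defines "c \<equiv> 2 * (p - 1) / (p + 1) * vvolume G \<mu> powr ((1 - p) / 2)"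
    and "y0 \<equiv> vintegral G \<mu> (\<lambda>x. (u0 x)\<^sup>2)"
  assumes p: "1 < p" and sol: "is_solution G \<mu> \<omega> p a u0 T u"
    and tau: "0 \<le> \<tau>" "ereal \<tau> < T"
    and y0: "0 < y0" and init: "4 * energy G \<mu> \<omega> p a u0 < c * y0 powr ((p + 1) / 2)"
  obtains y y' M M' where "dissipative_growth y y' M M' c ((p - 1) / 2) \<tau>"
    and "y 0 = y0" and "M 0 = - 4 * energy G \<mu> \<omega> p a u0"
proof -
  define I where "I = time_interval T"
  from sol obtain u' where u0: "\<And>x. x \<in> pverts G \<Longrightarrow> u x 0 = u0 x"
    and u': "\<And>x t. x \<in> pverts G \<Longrightarrow> t \<in> I \<Longrightarrow> (u x has_real_derivative u' x t) (at t within I)"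
    and eq: "\<And>x t. x \<in> pverts G \<Longrightarrow> t \<in> I \<Longrightarrow> 0 < t \<Longrightarrow>
        u' x t = reaction_diffusion G \<mu> \<omega> p a (\<lambda>y. u y t) x"
    unfolding is_solution_def reaction_diffusion_def I_def by blast
  have sub: "{0..\<tau>} \<subseteq> I"
  proof
    fix t assume t: "t \<in> {0..\<tau>}"
    then have "ereal t \<le> ereal \<tau>" by simp
    then have "ereal t < T" using tau(2) by (rule order.strict_trans1)
    then show "t \<in> I" using t by (simp add: I_def time_interval_def)
  qed
  have cont: "continuous_on {0..\<tau>} (u x)" if "x \<in> pverts G" for x
    using u'[OF that] sub by (meson DERIV_continuous_on continuous_on_subset)
  have deriv: "(u x has_real_derivative reaction_diffusion G \<mu> \<omega> p a (\<lambda>y. u y s) x) (at s)"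
    if "x \<in> pverts G" "0 < s" "s < \<tau>" for x s
  proof -
    have "at s within I = at s"
      using that sub by (intro at_within_open_subset[of _ "{0<..<\<tau>}"]) auto
    then show ?thesis
      using u'[of x s] eq[of x s] that sub by (simp add: subset_eq)
  qed
  have mass0: "vintegral G \<mu> (\<lambda>x. (u x 0)\<^sup>2) = y0"
    using u0 by (simp add: vintegral_def y0_def cong: sum.cong)
  have energy0: "energy G \<mu> \<omega> p a (\<lambda>x. u x 0) = energy G \<mu> \<omega> p a u0"
    by (rule energy_cong) (rule u0)
  have vol: "0 < vvolume G \<mu>"
    using y0 unfolding y0_def by (rule volume_pos_of_mass_pos)
  show ?thesis
  proof (rule that)
    show "dissipative_growth (\<lambda>s. vintegral G \<mu> (\<lambda>x. (u x s)\<^sup>2))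
        (\<lambda>s. 2 * vintegral G \<mu> (\<lambda>x. u x s * reaction_diffusion G \<mu> \<omega> p a (\<lambda>y. u y s) x))
        (\<lambda>s. - 4 * energy G \<mu> \<omega> p a (\<lambda>x. u x s))
        (\<lambda>s. 4 * vintegral G \<mu> (\<lambda>x. (reaction_diffusion G \<mu> \<omega> p a (\<lambda>y. u y s) x)\<^sup>2))
        c ((p - 1) / 2) \<tau>"
      unfolding c_def
    proof (rule dissipative_growth_of_solution[OF p tau(1) vol cont deriv])
      show "0 < vintegral G \<mu> (\<lambda>x. (u x 0)\<^sup>2)" using y0 mass0 by simp
      show "4 * energy G \<mu> \<omega> p a (\<lambda>x. u x 0)
          < 2 * (p - 1) / (p + 1) * vvolume G \<mu> powr ((1 - p) / 2)
              * vintegral G \<mu> (\<lambda>x. (u x 0)\<^sup>2) powr ((p + 1) / 2)"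
        using init unfolding mass0 energy0 c_def .
    qed
  qed (use mass0 energy0 in auto)
qed

end

lemma ereal_le_of_forall_less:
  assumes "0 < T" and le: "\<And>\<tau>. 0 \<le> \<tau> \<Longrightarrow> ereal \<tau> < T \<Longrightarrow> \<tau> \<le> B"
  shows "T \<le> ereal B"
proof (rule ccontr)
  assume "\<not> ?thesis"
  then have "max 0 (ereal B) < T" using \<open>0 < T\<close> by simp
  then obtain z where z: "max 0 (ereal B) < ereal z" "ereal z < T"
    using ereal_dense2 by blast
  then have "0 < ereal z" "ereal B < ereal z" by (auto simp del: ereal_less)
  then show False using le[of z] z(2) by simp
qed

section \<open>Bounds for the lifespan\<close>

lemma lifespan_neg_energy_eq:
  fixes N V p :: real
  assumes p: "1 < p" and N: "0 < N" and V: "0 < V"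
  defines "c \<equiv> 2 * (p - 1) / (p + 1) * V powr ((1 - p) / 2)"
  shows "(N\<^sup>2) powr (- ((p - 1) / 2)) / ((p - 1) / 2 * c)
    = (p + 1) / (p - 1)\<^sup>2 * V powr ((p - 1) / 2) * N powr (1 - p)"
proof -
  have e: "- ((p - 1) / 2) = (1 - p) / 2" "2 * ((1 - p) / 2) = 1 - p" by (auto simp: field_simps)
  have N2: "(N\<^sup>2) powr (- ((p - 1) / 2)) = N powr (1 - p)"
    using N by (simp only: e flip: powr_numeral) (simp only: powr_powr e)
  have V2: "V powr ((1 - p) / 2) = 1 / V powr ((p - 1) / 2)"
    by (simp only: powr_minus_divide flip: e(1))
  have "n / (d / 2 * (2 * d / s * (1 / E))) = s / d\<^sup>2 * E * n"
    if "d \<noteq> 0" "s \<noteq> 0" "E \<noteq> 0" for n d s E :: real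
    using that by (simp add: power2_eq_square)
  from this[of "p - 1" "p + 1" "V powr ((p - 1) / 2)"] show ?thesis
    using p V unfolding N2 c_def V2 by simp
qed

text \<open>
  With \<open>q = (p + 1) / 2\<close> and \<open>m = 4 * J\<close>, the first entry of the maximum on the right is
  \<open>(y\<^sub>1 - N\<^sup>2) / (c * (N\<^sup>2) powr q - m)\<close>, where \<open>y\<^sub>1 = N\<^sup>2 * (2 * w) powr (1 / q)\<close> solves
  \<open>c * y\<^sub>1 powr q = 2 * m\<close>.
\<close>
lemma lifespan_max_eq:
  fixes N V p J :: real
  assumes p: "1 < p" and N: "0 < N" and V: "0 < V" and J: "0 \<le> J"
  defines "c \<equiv> 2 * (p - 1) / (p + 1) * V powr ((1 - p) / 2)"
  assumes init: "4 * J < c * N powr (1 + p)"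
  defines "w \<equiv> 4 * J / (c * N powr (1 + p))"
  shows "(N\<^sup>2) powr (- ((p - 1) / 2)) / c
      * max (((2 * w) powr (1 / ((p - 1) / 2 + 1)) - 1) / (1 - w)) (2 / ((p - 1) / 2))
    = max
          ((p + 1) * ((4 * (p + 1) * V powr ((p - 1) / 2) * J) powr (2 / (p + 1))
                       - (p - 1) powr (2 / (p + 1)) * N\<^sup>2)
            / ((p - 1) powr (2 / (p + 1))
               * (2 * (p - 1) * V powr ((1 - p) / 2) * N powr (1 + p)
                  - 4 * (p + 1) * J)))
          (2 * (p + 1) * N powr (1 - p) / ((p - 1)\<^sup>2 * V powr ((1 - p) / 2)))"
proof -
  have e: "- ((p - 1) / 2) = (1 - p) / 2" "2 * ((1 - p) / 2) = 1 - p" by (auto simp: field_simps)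
  have N2: "(N\<^sup>2) powr (- ((p - 1) / 2)) = N powr (1 - p)"
    using N by (simp only: e flip: powr_numeral) (simp only: powr_powr e)
  have k: "1 / ((p - 1) / 2 + 1) = 2 / (p + 1)" using p by (simp add: field_simps)
  define D where "D = V powr ((1 - p) / 2)"
  define X where "X = N powr (1 + p)"
  define P where "P = (p - 1) powr (2 / (p + 1))"
  define W where "W = (2 * w) powr (2 / (p + 1))"
  have D: "0 < D" and X: "0 < X" and P: "0 < P" and c: "0 < c"
    using V N p by (auto simp: D_def X_def P_def c_def)
  have V2: "V powr ((p - 1) / 2) = 1 / D"
    unfolding D_def by (simp only: e(1)[symmetric] powr_minus_divide) simp
  have N3: "N powr (1 - p) = N\<^sup>2 / X"
    using N by (simp add: X_def powr_diff powr_add power2_eq_square)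
  have w: "0 \<le> w" "w < 1" and J_eq: "4 * J = w * c * X"
    using J init c X by (auto simp: w_def X_def)
  have c_eq: "2 * (p - 1) * D = (p + 1) * c"
    using p by (simp add: c_def D_def)
  have "4 * (p + 1) * (1 / D) * J = (p + 1) * (w * c * X) / D"
    by (simp flip: J_eq)
  also have "\<dots> = w * X * ((p + 1) * c) / D" by simp
  also have "\<dots> = (p - 1) * (2 * w) * X"
    using D by (simp flip: c_eq)
  finally have "(4 * (p + 1) * (1 / D) * J) powr (2 / (p + 1)) = P * W * X powr (2 / (p + 1))"
    using w X p by (simp add: P_def W_def powr_mult)
  also have "X powr (2 / (p + 1)) = N\<^sup>2"
  proof -
    have "(1 + p) * (2 / (p + 1)) = 2" using p by (simp add: field_simps)
    then show ?thesis using N by (simp only: X_def powr_powr) (simp add: powr_numeral)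
  qed
  finally have Q: "(4 * (p + 1) * (1 / D) * J) powr (2 / (p + 1)) = P * W * N\<^sup>2" .
  have den: "2 * (p - 1) * D * X - 4 * (p + 1) * J = (p + 1) * (c * X * (1 - w))"
  proof -
    have "4 * (p + 1) * J = (p + 1) * (w * c * X)" by (simp flip: J_eq)
    then show ?thesis unfolding c_eq by (simp add: algebra_simps)
  qed
  have A: "(p + 1) * (P * W * N\<^sup>2 - P * N\<^sup>2) / (P * ((p + 1) * (c * X * (1 - w))))
      = N\<^sup>2 / X / c * ((W - 1) / (1 - w))"
  proof -
    have "(p + 1) * (P * W * N\<^sup>2 - P * N\<^sup>2) / (P * ((p + 1) * (c * X * (1 - w))))
        = (P * (p + 1)) * (N\<^sup>2 * (W - 1)) / ((P * (p + 1)) * (X * c * (1 - w)))"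
      by (simp add: algebra_simps)
    also have "\<dots> = (N\<^sup>2 * (W - 1)) / (X * c * (1 - w))"
      using P p by (intro mult_divide_mult_cancel_left) auto
    finally show ?thesis by simp
  qed
  have B: "2 * (p + 1) * (N\<^sup>2 / X) / ((p - 1)\<^sup>2 * D) = N\<^sup>2 / X / c * (2 / ((p - 1) / 2))"
  proof -
    have *: "2 * s * n / (d\<^sup>2 * D) = n / (2 * d / s * D) * (2 / (d / 2))"
      if "d \<noteq> 0" "s \<noteq> 0" for n d s :: real
      using that D by (simp add: field_simps power2_eq_square)
    show ?thesis
      unfolding c_def D_def[symmetric] by (rule *) (use p in auto)
  qed
  have "0 \<le> N\<^sup>2 / X / c" using X c by simp
  then show ?thesis
    unfolding k N2 V2 D_def[symmetric] X_def[symmetric] P_def[symmetric] N3 Q den A B W_def[symmetric]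
    by (simp add: max_mult_distrib_left)
qed

theorem theorem2p5:
  fixes G :: "'a pair_pre_digraph"
    and \<mu> :: "'a \<Rightarrow> real" and \<omega> :: "'a \<Rightarrow> 'a \<Rightarrow> real"
    and p :: real and a u0 :: "'a \<Rightarrow> real"
    and u :: "'a \<Rightarrow> real \<Rightarrow> real"
  assumes "weighted_graph G \<mu> \<omega>"
    and "p > 1"
    and "\<forall>x\<in>pverts G. a x \<ge> 0" and "\<exists>x\<in>pverts G. a x \<noteq> 0"
    and "\<forall>x\<in>pverts G. u0 x \<ge> 0"
    and "is_solution G \<mu> \<omega> p a u0 (T_max G \<mu> \<omega> p a u0) u"
  shows "(energy G \<mu> \<omega> p a u0 < 0 \<longrightarrow>
      T_max G \<mu> \<omega> p a u0 \<le>
        ereal ((p + 1) / (p - 1)\<^sup>2 * vvolume G \<mu> powr ((p - 1) / 2) * vnorm2 G \<mu> u0 powr (1 - p)))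
    \<and> (0 \<le> energy G \<mu> \<omega> p a u0 \<and>
       energy G \<mu> \<omega> p a u0 <
         (p - 1) / (2 * (p + 1)) * vvolume G \<mu> powr ((1 - p) / 2) * vnorm2 G \<mu> u0 powr (1 + p) \<longrightarrow>
      T_max G \<mu> \<omega> p a u0 \<le>
        ereal (max
          ((p + 1) * ((4 * (p + 1) * vvolume G \<mu> powr ((p - 1) / 2) * energy G \<mu> \<omega> p a u0)
                         powr (2 / (p + 1))
                       - (p - 1) powr (2 / (p + 1)) * (vnorm2 G \<mu> u0)\<^sup>2)
            / ((p - 1) powr (2 / (p + 1))
               * (2 * (p - 1) * vvolume G \<mu> powr ((1 - p) / 2) * vnorm2 G \<mu> u0 powr (1 + p)
                  - 4 * (p + 1) * energy G \<mu> \<omega> p a u0)))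
          (2 * (p + 1) * vnorm2 G \<mu> u0 powr (1 - p)
            / ((p - 1)\<^sup>2 * vvolume G \<mu> powr ((1 - p) / 2)))))"
proof -
  interpret weighted_graph G \<mu> \<omega> by (rule assms(1))
  note p = \<open>p > 1\<close> and sol = assms(6)
  define T where "T = T_max G \<mu> \<omega> p a u0"
  define N where "N = vnorm2 G \<mu> u0"
  define V where "V = vvolume G \<mu>"
  define J where "J = energy G \<mu> \<omega> p a u0"
  define c where "c = 2 * (p - 1) / (p + 1) * V powr ((1 - p) / 2)"
  have "0 < T" using sol by (simp add: is_solution_def T_def)
  have N_nonneg: "0 \<le> N" and N_sq: "N\<^sup>2 = vintegral G \<mu> (\<lambda>x. (u0 x)\<^sup>2)"
    using measure_pos
    by (auto simp: N_def vnorm2_def vintegral_def intro!: sum_nonneg mult_nonneg_nonneg less_imp_le[OF measure_pos])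
  have N_powr: "(N\<^sup>2) powr ((p + 1) / 2) = N powr (1 + p)" if "0 < N"
  proof -
    have "2 * ((p + 1) / 2) = 1 + p" by simp
    then show ?thesis
      using that by (simp only: powr_powr flip: powr_numeral)
  qed
  have half: "1 + (p - 1) / 2 = (p + 1) / 2" by (simp add: field_simps)

  have neg: "T \<le> ereal ((p + 1) / (p - 1)\<^sup>2 * V powr ((p - 1) / 2) * N powr (1 - p))"
    if "J < 0"
  proof -
    have y0: "0 < N\<^sup>2" using that unfolding J_def N_sq by (rule mass_pos_of_energy_neg)
    then have N: "0 < N" using N_nonneg by (simp add: zero_less_power_eq)
    have V: "0 < V" using y0 unfolding N_sq V_def by (rule volume_pos_of_mass_pos)
    have "0 < c * (N\<^sup>2) powr ((p + 1) / 2)" using p V y0 by (simp add: c_def)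
    then have init: "4 * J < c * (N\<^sup>2) powr ((p + 1) / 2)" using that by simp
    show ?thesis
    proof (rule ereal_le_of_forall_less[OF \<open>0 < T\<close>])
      fix \<tau> assume tau: "0 \<le> \<tau>" "ereal \<tau> < T"
      obtain y y' M M' where D: "dissipative_growth y y' M M' c ((p - 1) / 2) \<tau>"
        and y: "y 0 = N\<^sup>2" and M: "M 0 = - 4 * J"
        using dissipative_growth_of_is_solution[OF p sol[folded T_def] tau] y0 init
        unfolding N_sq J_def c_def V_def by metis
      have "\<tau> \<le> (N\<^sup>2) powr (- ((p - 1) / 2)) / ((p - 1) / 2 * c)"
        using dissipative_growth.time_le_if_M_nonneg[OF D] that unfolding y M by simp
      then show "\<tau> \<le> (p + 1) / (p - 1)\<^sup>2 * V powr ((p - 1) / 2) * N powr (1 - p)"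
        unfolding c_def lifespan_neg_energy_eq[OF p N V] .
    qed
  qed

  have nonneg: "T \<le> ereal (max
          ((p + 1) * ((4 * (p + 1) * V powr ((p - 1) / 2) * J) powr (2 / (p + 1))
                       - (p - 1) powr (2 / (p + 1)) * N\<^sup>2)
            / ((p - 1) powr (2 / (p + 1))
               * (2 * (p - 1) * V powr ((1 - p) / 2) * N powr (1 + p) - 4 * (p + 1) * J)))
          (2 * (p + 1) * N powr (1 - p) / ((p - 1)\<^sup>2 * V powr ((1 - p) / 2))))"
    if J: "0 \<le> J" and J_less: "J < (p - 1) / (2 * (p + 1)) * V powr ((1 - p) / 2) * N powr (1 + p)"
  proof -
    have "N \<noteq> 0" using J J_less by auto
    then have N: "0 < N" using N_nonneg by simp
    then have y0: "0 < N\<^sup>2" by simp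
    have V: "0 < V" using y0 unfolding N_sq V_def by (rule volume_pos_of_mass_pos)
    have init': "4 * J < c * N powr (1 + p)"
    proof -
      have "4 * (d / (2 * s) * E * X) = 2 * d / s * E * X" for d s E X :: real
        by simp
      then have "4 * ((p - 1) / (2 * (p + 1)) * V powr ((1 - p) / 2) * N powr (1 + p)) = c * N powr (1 + p)"
        unfolding c_def .
      then show ?thesis using J_less by linarith
    qed
    then have init: "4 * J < c * (N\<^sup>2) powr ((p + 1) / 2)" by (simp only: N_powr[OF N])
    define w where "w = 4 * J / (c * N powr (1 + p))"
    have "0 < c" using p V by (simp add: c_def)
    have w: "0 \<le> w" "w < 1"
      using J init' \<open>0 < c\<close> N by (auto simp: w_def)
    show ?thesis
    proof (rule ereal_le_of_forall_less[OF \<open>0 < T\<close>])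
      fix \<tau> assume tau: "0 \<le> \<tau>" "ereal \<tau> < T"
      obtain y y' M M' where D: "dissipative_growth y y' M M' c ((p - 1) / 2) \<tau>"
        and y: "y 0 = N\<^sup>2" and M: "M 0 = - 4 * J"
        using dissipative_growth_of_is_solution[OF p sol[folded T_def] tau] y0 init
        unfolding N_sq J_def c_def V_def by metis
      have w_eq: "- M 0 / (c * y 0 powr (1 + (p - 1) / 2)) = w"
        unfolding y M half N_powr[OF N] w_def by simp
      have "\<tau> \<le> (N\<^sup>2) powr (- ((p - 1) / 2)) / c
          * (ln ((1 + 1 / ((p - 1) / 2)) / (1 - w)) / (1 + (p - 1) / 2 * w))"
        using dissipative_growth.time_le_if_M_nonpos[OF D] J unfolding w_eq unfolding y M by simp
      also have "\<dots> \<le> (N\<^sup>2) powr (- ((p - 1) / 2)) / c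
          * max (((2 * w) powr (1 / ((p - 1) / 2 + 1)) - 1) / (1 - w)) (2 / ((p - 1) / 2))"
        using p w \<open>0 < c\<close> by (intro mult_left_mono bernoulli_time_le_max) auto
      also note lifespan_max_eq[OF p N V J init'[unfolded c_def], folded c_def, folded w_def]
      finally show "\<tau> \<le> max
          ((p + 1) * ((4 * (p + 1) * V powr ((p - 1) / 2) * J) powr (2 / (p + 1))
                       - (p - 1) powr (2 / (p + 1)) * N\<^sup>2)
            / ((p - 1) powr (2 / (p + 1))
               * (2 * (p - 1) * V powr ((1 - p) / 2) * N powr (1 + p) - 4 * (p + 1) * J)))
          (2 * (p + 1) * N powr (1 - p) / ((p - 1)\<^sup>2 * V powr ((1 - p) / 2)))" .
    qed
  qed
  show ?thesis
    using neg nonneg unfolding T_def N_def V_def J_def by blast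
qed

end
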